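(* Let $d\ge3$ and $g\ge6$, and let $S_{g,d}$ be the cycle $C_g$ with $d-2$ pendant leaves at each cycle vertex (so every cycle vertex has degree $d$). Then $$\lambda_{\max}(R_{S_{g,d}})=\frac{2\big(\sqrt{d-1}-1\big)}{d},$$ independent of $g$, with a positive (Perron) eigenvector. Hence this eigenvector is a discrete Einstein metric on $S_{g,d}$ with curvature $\kappa(S_{g,d})=-\lambda_{\max}(R_{S_{g,d}})<0$.
   Context: Weighted graphs: $G=(V,E)$ is a finite connected simple graph, $w:E\to\mathbb{R}_{>0}$ an edge weighting, $d_v$ the combinatorial degree, and $d(x,y)$ the least total weight of a path from $x$ to $y$. Lin--Lu--Yau curvature: for $\alpha\in[0,1]$ let $\mu_x^\alpha$ be the probability measure with mass $\alpha$ at $x$ and $(1-\alpha)/d_x$ at each neighbour of $x$. Let $W$ be the $L^1$-Wasserstein distance with respect to $d$. For an edge $x\sim y$ put $\kappa_\alpha(x,y)=1-W(\mu_x^\alpha,\mu_y^\alpha)/d(x,y)$ and $\kappa_{xy}=\lim_{\alpha\to1}\kappa_\alpha(x,y)/(1-\alpha)$. A positive weighting $w$ is a discrete Einstein metric of curvature $\kappa$ if $\kappa_e=\kappa$ for every edge $e$. Ricci matrix: $R_G\in\mathbb{R}^{E\times E}$ has diagonal entries $-(1/d_x+1/d_y)$ for $e=\{x,y\}$, entry $1/d_z$ for $e\ne e'$ with $e\cap e'=\{z\}$, and $0$ for disjoint edges; $\lambda_{\max}$ denotes its largest eigenvalue. *)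

theory Defs
  imports "HOL-Probability.Probability"
begin

section \<open>Simple graphs\<close>

text \<open>
  A simple graph is a vertex set together with a set of two-element subsets of it. Degrees,
  distances and curvature depend on the edge set only.
\<close>

definition nbrs :: "'a set set \<Rightarrow> 'a \<Rightarrow> 'a set" where
  "nbrs E x = {y. {x, y} \<in> E}"

definition degree :: "'a set set \<Rightarrow> 'a \<Rightarrow> nat" where
  "degree E x = card (nbrs E x)"

definition is_path :: "'a set set \<Rightarrow> 'a \<Rightarrow> 'a \<Rightarrow> 'a list \<Rightarrow> bool" where
  "is_path E x y p \<longleftrightarrow> p \<noteq> [] \<and> hd p = x \<and> last p = y \<and> distinct p \<and>
     successively (\<lambda>u v. {u, v} \<in> E) p"

definition finite_connected_simple_graph :: "'a set \<Rightarrow> 'a set set \<Rightarrow> bool" where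
  "finite_connected_simple_graph V E \<longleftrightarrow> finite V \<and> V \<noteq> {} \<and>
     (\<forall>e\<in>E. e \<subseteq> V \<and> card e = 2) \<and> (\<forall>x\<in>V. \<forall>y\<in>V. \<exists>p. is_path E x y p)"

definition path_weight :: "('a set \<Rightarrow> real) \<Rightarrow> 'a list \<Rightarrow> real" where
  "path_weight w p = (\<Sum>(u, v)\<leftarrow>zip p (tl p). w {u, v})"

text \<open>
  In a finite connected graph the infimum is over a finite nonempty set, hence is attained.
\<close>

definition graph_dist :: "'a set set \<Rightarrow> ('a set \<Rightarrow> real) \<Rightarrow> 'a \<Rightarrow> 'a \<Rightarrow> real" where
  "graph_dist E w x y = (INF p\<in>{p. is_path E x y p}. path_weight w p)"


section \<open>Lin--Lu--Yau curvature\<close>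

definition lazy_measure :: "'a set set \<Rightarrow> real \<Rightarrow> 'a \<Rightarrow> 'a pmf" where
  "lazy_measure E \<alpha> x =
     bind_pmf (bernoulli_pmf \<alpha>) (\<lambda>b. if b then return_pmf x else pmf_of_set (nbrs E x))"

lemma pmf_lazy_measure:
  assumes "\<alpha> \<in> {0..1}" "finite (nbrs E x)" "nbrs E x \<noteq> {}" "{x} \<notin> E"
  shows "pmf (lazy_measure E \<alpha> x) y =
    (if y = x then \<alpha> else if {x, y} \<in> E then (1 - \<alpha>) / degree E x else 0)"
  using assms
  by (auto simp: lazy_measure_def pmf_bind integral_bernoulli_pmf nbrs_def degree_def indicator_def)

definition couplings :: "'a pmf \<Rightarrow> 'a pmf \<Rightarrow> ('a \<times> 'a) pmf set" where
  "couplings \<mu> \<nu> = {\<pi>. map_pmf fst \<pi> = \<mu> \<and> map_pmf snd \<pi> = \<nu>}"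

text \<open>
  Only used for finitely supported measures, where every coupling is finitely supported and the
  cost is therefore integrable.
\<close>

definition wasserstein :: "('a \<Rightarrow> 'a \<Rightarrow> real) \<Rightarrow> 'a pmf \<Rightarrow> 'a pmf \<Rightarrow> real" where
  "wasserstein c \<mu> \<nu> =
     (INF \<pi>\<in>couplings \<mu> \<nu>. measure_pmf.expectation \<pi> (\<lambda>(x, y). c x y))"

definition lazy_curvature :: "'a set set \<Rightarrow> ('a set \<Rightarrow> real) \<Rightarrow> real \<Rightarrow> 'a \<Rightarrow> 'a \<Rightarrow> real" where
  "lazy_curvature E w \<alpha> x y =
     1 - wasserstein (graph_dist E w) (lazy_measure E \<alpha> x) (lazy_measure E \<alpha> y)
           / graph_dist E w x y"

text \<open>
  The limit is from the left because the idleness \<open>\<alpha>\<close> ranges over the unit interval; existence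
  of the limit is part of the predicate.
\<close>

definition has_LLY_curvature ::
    "'a set set \<Rightarrow> ('a set \<Rightarrow> real) \<Rightarrow> 'a \<Rightarrow> 'a \<Rightarrow> real \<Rightarrow> bool" where
  "has_LLY_curvature E w x y \<kappa> \<longleftrightarrow>
     ((\<lambda>\<alpha>. lazy_curvature E w \<alpha> x y / (1 - \<alpha>)) \<longlongrightarrow> \<kappa>) (at_left 1)"

definition discrete_Einstein_metric :: "'a set set \<Rightarrow> ('a set \<Rightarrow> real) \<Rightarrow> real \<Rightarrow> bool" where
  "discrete_Einstein_metric E w \<kappa> \<longleftrightarrow>
     (\<forall>e\<in>E. 0 < w e) \<and> (\<forall>x y. {x, y} \<in> E \<longrightarrow> has_LLY_curvature E w x y \<kappa>)"


section \<open>The Ricci matrix and its spectrum\<close>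

text \<open>
  A matrix with rows and columns indexed by a finite set \<open>I\<close> is a function of two
  arguments, of which only the values on \<open>I\<close> matter; likewise for vectors.
\<close>

definition eigenvector_on ::
    "'i set \<Rightarrow> ('i \<Rightarrow> 'i \<Rightarrow> real) \<Rightarrow> ('i \<Rightarrow> real) \<Rightarrow> real \<Rightarrow> bool" where
  "eigenvector_on I A v c \<longleftrightarrow>
     (\<exists>i\<in>I. v i \<noteq> 0) \<and> (\<forall>i\<in>I. (\<Sum>j\<in>I. A i j * v j) = c * v i)"

definition eigenvalue_on :: "'i set \<Rightarrow> ('i \<Rightarrow> 'i \<Rightarrow> real) \<Rightarrow> real \<Rightarrow> bool" where
  "eigenvalue_on I A c \<longleftrightarrow> (\<exists>v. eigenvector_on I A v c)"

definition lambda_max :: "'i set \<Rightarrow> ('i \<Rightarrow> 'i \<Rightarrow> real) \<Rightarrow> real" where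
  "lambda_max I A = (GREATEST c. eigenvalue_on I A c)"

text \<open>
  Distinct edges share at most one vertex, so the off-diagonal sum has one term if they are
  adjacent and none if they are disjoint.
\<close>

definition ricci_matrix :: "'a set set \<Rightarrow> 'a set \<Rightarrow> 'a set \<Rightarrow> real" where
  "ricci_matrix E e e' =
     (if e = e' then - (\<Sum>x\<in>e. 1 / degree E x) else (\<Sum>z\<in>e \<inter> e'. 1 / degree E z))"


section \<open>Cycles with pendant leaves\<close>

datatype sun_vertex = Cyc nat | Leaf nat nat

definition sun_verts :: "nat \<Rightarrow> nat \<Rightarrow> sun_vertex set" where
  "sun_verts g d = {Cyc i | i. i < g} \<union> {Leaf i j | i j. i < g \<and> j < d - 2}"

definition sun_edges :: "nat \<Rightarrow> nat \<Rightarrow> sun_vertex set set" where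
  "sun_edges g d =
     {{Cyc i, Cyc (Suc i mod g)} | i. i < g} \<union> {{Cyc i, Leaf i j} | i j. i < g \<and> j < d - 2}"

lemma nbrs_sun_Cyc:
  assumes "g \<ge> 3" "i < g"
  shows "nbrs (sun_edges g d) (Cyc i) =
    {Cyc (Suc i mod g), Cyc ((i + g - 1) mod g)} \<union> Leaf i ` {..<d - 2}" (is "?L = ?R")
proof -
  have pred: "Suc ((i + g - 1) mod g) mod g = i"
    using assms by (simp add: mod_simps Suc_diff_le)
  have succ: "(Suc k mod g + g - 1) mod g = k" if "k < g" for k
    using assms that by (cases "Suc k = g") (auto simp: mod_if)
  show ?thesis
  proof (intro equalityI subsetI)
    fix y assume "y \<in> ?L"
    then show "y \<in> ?R"
      using succ by (auto simp: nbrs_def sun_edges_def doubleton_eq_iff)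
  next
    fix y assume "y \<in> ?R"
    then consider "y = Cyc (Suc i mod g)" | "y = Cyc ((i + g - 1) mod g)"
      | j where "y = Leaf i j" "j < d - 2" by auto
    then show "y \<in> ?L"
    proof cases
      case 2
      have "(i + g - 1) mod g < g" using assms by simp
      moreover have "{Cyc i, y} = {Cyc ((i + g - 1) mod g), Cyc (Suc ((i + g - 1) mod g) mod g)}"
        unfolding 2 pred by (rule insert_commute)
      ultimately show ?thesis unfolding nbrs_def sun_edges_def by blast
    qed (use assms in \<open>auto simp: nbrs_def sun_edges_def\<close>)
  qed
qed

lemma degree_sun_Cyc:
  assumes "g \<ge> 3" "d \<ge> 2" "i < g"
  shows "degree (sun_edges g d) (Cyc i) = d"
proof -
  have ne: "Suc i mod g \<noteq> (i + g - 1) mod g"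
    using assms by (cases "Suc i = g"; cases i) (auto simp: mod_if)
  have "card ({Cyc (Suc i mod g), Cyc ((i + g - 1) mod g)} \<union> Leaf i ` {..<d - 2}) =
    card {Cyc (Suc i mod g), Cyc ((i + g - 1) mod g)} + card (Leaf i ` {..<d - 2})"
    by (rule card_Un_disjoint) auto
  also have "\<dots> = 2 + (d - 2)"
    using ne by (simp add: card_image inj_on_def)
  finally show ?thesis using assms by (simp add: degree_def nbrs_sun_Cyc)
qed

lemma degree_sun_Leaf:
  assumes "i < g" "j < d - 2"
  shows "degree (sun_edges g d) (Leaf i j) = 1"
proof -
  have "nbrs (sun_edges g d) (Leaf i j) = {Cyc i}"
    using assms by (auto simp: nbrs_def sun_edges_def doubleton_eq_iff)
  then show ?thesis by (simp add: degree_def)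
qed

lemma is_path_rev: "is_path E x y p \<Longrightarrow> is_path E y x (rev p)"
  by (auto simp: is_path_def hd_rev last_rev insert_commute)

lemma is_path_Cons:
  "is_path E x y p \<Longrightarrow> {z, x} \<in> E \<Longrightarrow> z \<notin> set p \<Longrightarrow> is_path E z y (z # p)"
  by (auto simp: is_path_def successively_Cons)

lemma finite_connected_simple_graph_sun:
  assumes "g \<ge> 3"
  shows "finite_connected_simple_graph (sun_verts g d) (sun_edges g d)"
proof -
  let ?E = "sun_edges g d"
  have "sun_verts g d = Cyc ` {..<g} \<union> (\<lambda>(i, j). Leaf i j) ` ({..<g} \<times> {..<d - 2})"
    by (auto simp: sun_verts_def)
  then have fin: "finite (sun_verts g d)" by simp
  have ne: "sun_verts g d \<noteq> {}"
    using assms by (auto simp: sun_verts_def intro!: exI[of _ 0])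
  have ns: "i \<noteq> Suc i mod g" if "i < g" for i
    using assms that by (auto simp: mod_if)
  have simple: "\<forall>e\<in>?E. e \<subseteq> sun_verts g d \<and> card e = 2"
    using assms ns by (auto simp: sun_edges_def sun_verts_def)
  have up: "is_path ?E (Cyc i) (Cyc j) (map Cyc [i..<Suc j])" if "i \<le> j" "j < g" for i j
    using that
  proof (induction j rule: dec_induct)
    case base
    then show ?case by (simp add: is_path_def)
  next
    case (step j)
    then have "{Cyc j, Cyc (Suc j)} \<in> ?E"
      unfolding sun_edges_def by (force intro!: exI[of _ j])
    with step show ?case
      by (auto simp: is_path_def successively_append_iff hd_append last_map distinct_map
          split: if_splits)
  qed
  have cyc: "\<exists>p. is_path ?E (Cyc i) (Cyc j) p \<and> set p \<subseteq> range Cyc" if "i < g" "j < g" for i j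
  proof (cases "i \<le> j")
    case True
    then show ?thesis using up[of i j] that by (metis set_map image_mono top_greatest)
  next
    case False
    then show ?thesis using is_path_rev[OF up[of j i]] that
      by (intro exI[of _ "rev (map Cyc [j..<Suc i])"]) auto
  qed
  have leaf: "{Leaf i j, Cyc i} \<in> ?E" if "i < g" "j < d - 2" for i j
    using that by (auto simp: sun_edges_def)
  have lc: "\<exists>p. is_path ?E (Leaf i k) (Cyc j) p \<and> set p \<subseteq> insert (Leaf i k) (range Cyc)"
    if ijk: "i < g" "j < g" "k < d - 2" for i j k
  proof -
    obtain p where "is_path ?E (Cyc i) (Cyc j) p" "set p \<subseteq> range Cyc" using cyc ijk by blast
    then show ?thesis using leaf[OF ijk(1,3)]
      by (intro exI[of _ "Leaf i k # p"] conjI is_path_Cons) auto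
  qed
  have ll: "\<exists>p. is_path ?E (Leaf i k) (Leaf j l) p"
    if ijkl: "i < g" "j < g" "k < d - 2" "l < d - 2" for i j k l
  proof (cases "Leaf i k = Leaf j l")
    case True
    then show ?thesis by (intro exI[of _ "[Leaf i k]"]) (auto simp: is_path_def)
  next
    case False
    obtain p where p: "is_path ?E (Leaf i k) (Cyc j) p" "set p \<subseteq> insert (Leaf i k) (range Cyc)"
      using lc ijkl by blast
    have "is_path ?E (Leaf j l) (Leaf i k) (Leaf j l # rev p)"
      using is_path_rev[OF p(1)] p(2) leaf[OF ijkl(2,4)] False by (intro is_path_Cons) auto
    from is_path_rev[OF this] show ?thesis ..
  qed
  have "\<exists>p. is_path ?E x y p" if "x \<in> sun_verts g d" "y \<in> sun_verts g d" for x y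
  proof -
    have sym: "\<exists>p. is_path ?E v u p" if "\<exists>p. is_path ?E u v p" for u v
      using that by (metis is_path_rev)
    show ?thesis using that unfolding sun_verts_def
      by (auto intro: ll) (use cyc lc sym in blast)+
  qed
  then show ?thesis using fin ne simple by (simp add: finite_connected_simple_graph_def)
qed

end

theory Submission
  imports Defs
begin

text \<open>
  On an edge \<open>xy\<close> whose optimal transport is certified by one potential \<open>f\<close> (1-Lipschitz along edges,
  tight on a coupling), the curvature is \<open>1 - (mean of f around x - mean of f around y) / w(xy)\<close>. If
  the cycle edges all have weight \<open>b\<close> and the leaf edges weight \<open>a\<close>, such potentials exist; on a cycle
  edge this is where \<open>g \<ge> 6\<close> enters, as the potential falls by \<open>3b\<close> across three consecutive cycle
  edges and has to climb back along the remaining \<open>g - 3\<close>.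

  With \<open>s = sqrt (d - 1)\<close>, the vector with \<open>b = (1 + s) a\<close> is a positive eigenvector for
  \<open>2 (s - 1) / d\<close>, which is therefore the largest eigenvalue (Perron--Frobenius). For an arbitrary
  eigenvector with this eigenvalue, eliminating the leaf weights makes the weights of the cycle edges a
  harmonic function on the cycle, hence constant; so it is a multiple of this one.
\<close>

section \<open>Path weights and the weighted distance\<close>

lemma path_weight_simps [simp]:
  "path_weight w [x] = 0"
  "path_weight w (x # y # p) = w {x, y} + path_weight w (y # p)"
  by (simp_all add: path_weight_def)

lemma path_weight_snoc:
  "p \<noteq> [] \<Longrightarrow> path_weight w (p @ [z]) = path_weight w p + w {last p, z}"
  by (induction p rule: induct_list012) auto

lemma path_weight_rev: "path_weight w (rev p) = path_weight w p"
proof (induction p rule: induct_list012)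
  case (3 x y zs)
  then show ?case
    using path_weight_snoc[of "rev (y # zs)" w x] by (simp add: last_rev insert_commute)
qed (simp_all add: path_weight_def)

text \<open>The increments of \<open>f\<close> telescope along the path. A constant \<open>f\<close>
  gives nonnegativity of path weights.\<close>

lemma path_weight_ge_diff:
  assumes "is_path E x y p" and "\<And>u v. {u, v} \<in> E \<Longrightarrow> f u - f v \<le> w {u, v}"
  shows "f x - f y \<le> path_weight w p"
proof -
  have "p \<noteq> [] \<Longrightarrow> successively (\<lambda>u v. {u, v} \<in> E) p \<Longrightarrow> f (hd p) - f (last p) \<le> path_weight w p"
  proof (induction p rule: induct_list012)
    case (3 u v p)
    then have "f v - f (last (v # p)) \<le> path_weight w (v # p)" "f u - f v \<le> w {u, v}"
      using assms(2) by auto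
    then show ?case by simp
  qed auto
  then show ?thesis using assms(1) by (auto simp: is_path_def)
qed

text \<open>The path \<open>p\<close> makes the index set of the infimum nonempty; an infimum over
  the empty set would carry no information.\<close>

lemma graph_dist_ge_diff:
  assumes "is_path E x y p" and "\<And>u v. {u, v} \<in> E \<Longrightarrow> f u - f v \<le> w {u, v}"
  shows "f x - f y \<le> graph_dist E w x y"
  unfolding graph_dist_def
  using assms by (intro cINF_greatest) (auto intro: path_weight_ge_diff)

lemma graph_dist_le_path_weight:
  assumes "is_path E x y p" and "\<And>e. e \<in> E \<Longrightarrow> 0 \<le> w e"
  shows "graph_dist E w x y \<le> path_weight w p"
proof -
  \<comment> \<open>A real infimum lies below its members only if the set is bounded below; the
    constant potential provides the bound 0.\<close>
  have "bdd_below (path_weight w ` {p. is_path E x y p})"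
    using path_weight_ge_diff[of E x y _ "\<lambda>_. 0" w] assms(2) by (intro bdd_belowI[of _ 0]) auto
  then show ?thesis
    unfolding graph_dist_def using assms(1) by (intro cINF_lower) auto
qed

lemma graph_dist_commute: "graph_dist E w x y = graph_dist E w y x"
proof -
  have "path_weight w ` {p. is_path E x y p} = path_weight w ` {p. is_path E y x p}" for x y
  proof -
    have "path_weight w ` {p. is_path E x y p} \<subseteq> path_weight w ` {p. is_path E y x p}" for x y
      using is_path_rev[of E x y] by (auto intro!: image_eqI[of _ _ "rev _"] simp: path_weight_rev)
    then show ?thesis by blast
  qed
  then show ?thesis by (simp add: graph_dist_def)
qed

section \<open>Transport cost: symmetry and duality\<close>

lemma wasserstein_commute:
  assumes "\<And>u v. c u v = c v u"
  shows "wasserstein c \<mu> \<nu> = wasserstein c \<nu> \<mu>"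
proof -
  let ?cost = "\<lambda>\<pi>. measure_pmf.expectation \<pi> (\<lambda>(u, v). c u v)"
  have "?cost ` couplings \<mu> \<nu> \<subseteq> ?cost ` couplings \<nu> \<mu>" for \<mu> \<nu>
  proof safe
    fix \<pi> assume "\<pi> \<in> couplings \<mu> \<nu>"
    then have "map_pmf prod.swap \<pi> \<in> couplings \<nu> \<mu>"
      by (auto simp: couplings_def map_pmf_comp)
    moreover have "?cost \<pi> = ?cost (map_pmf prod.swap \<pi>)"
      by (simp add: integral_map_pmf case_prod_unfold assms)
    ultimately show "?cost \<pi> \<in> ?cost ` couplings \<nu> \<mu>" by blast
  qed
  then have "?cost ` couplings \<mu> \<nu> = ?cost ` couplings \<nu> \<mu>" by blast
  then show ?thesis by (simp add: wasserstein_def)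
qed

text \<open>The Einstein condition ranges over ordered pairs; by symmetry each edge has to be
  treated in one orientation only.\<close>

lemma has_LLY_curvature_commute:
  "has_LLY_curvature E w x y \<kappa> \<longleftrightarrow> has_LLY_curvature E w y x \<kappa>"
proof -
  have W: "wasserstein (graph_dist E w) \<mu> \<nu> = wasserstein (graph_dist E w) \<nu> \<mu>" for \<mu> \<nu>
    by (intro wasserstein_commute graph_dist_commute)
  then show ?thesis
    unfolding has_LLY_curvature_def lazy_curvature_def
    by (subst W, subst graph_dist_commute) (rule refl)
qed

text \<open>Complementary slackness in Kantorovich duality.\<close>

lemma wasserstein_eqI:
  fixes f :: "'a \<Rightarrow> real"
  assumes fin: "finite (set_pmf \<mu>)" "finite (set_pmf \<nu>)"
    and lip: "\<And>u v. u \<in> set_pmf \<mu> \<Longrightarrow> v \<in> set_pmf \<nu> \<Longrightarrow> f u - f v \<le> c u v"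
    and \<pi>: "\<pi> \<in> couplings \<mu> \<nu>"
    and tight: "\<And>u v. (u, v) \<in> set_pmf \<pi> \<Longrightarrow> c u v \<le> f u - f v"
  shows "wasserstein c \<mu> \<nu> = measure_pmf.expectation \<mu> f - measure_pmf.expectation \<nu> f"
proof -
  have supp: "set_pmf \<rho> \<subseteq> set_pmf \<mu> \<times> set_pmf \<nu>" if "\<rho> \<in> couplings \<mu> \<nu>" for \<rho>
    using that by (force simp: couplings_def)
  have int: "integrable (measure_pmf \<rho>) h" if "\<rho> \<in> couplings \<mu> \<nu>" for \<rho> and h :: "'a \<times> 'a \<Rightarrow> real"
    using supp[OF that] fin by (intro integrable_measure_pmf_finite) (auto intro: finite_subset)
  \<comment> \<open>The expected drop of \<open>f\<close> depends on the marginals alone, so it is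
    the same for all couplings.\<close>
  have diff: "measure_pmf.expectation \<rho> (\<lambda>(u, v). f u - f v) =
      measure_pmf.expectation \<mu> f - measure_pmf.expectation \<nu> f"
    if "\<rho> \<in> couplings \<mu> \<nu>" for \<rho>
  proof -
    have "measure_pmf.expectation \<rho> (\<lambda>(u, v). f u - f v) =
      measure_pmf.expectation (map_pmf fst \<rho>) f - measure_pmf.expectation (map_pmf snd \<rho>) f"
      using int[OF that] by (simp add: case_prod_unfold)
    then show ?thesis using that by (simp only: couplings_def mem_Collect_eq)
  qed
  have ge: "measure_pmf.expectation \<mu> f - measure_pmf.expectation \<nu> f
      \<le> measure_pmf.expectation \<rho> (\<lambda>(u, v). c u v)" if "\<rho> \<in> couplings \<mu> \<nu>" for \<rho>
    unfolding diff[OF that, symmetric] using supp[OF that] lip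
    by (intro integral_mono_AE int that) (auto simp: AE_measure_pmf_iff)
  moreover have "measure_pmf.expectation \<pi> (\<lambda>(u, v). c u v)
      \<le> measure_pmf.expectation \<mu> f - measure_pmf.expectation \<nu> f"
    unfolding diff[OF \<pi>, symmetric] using tight
    by (intro integral_mono_AE int \<pi>) (auto simp: AE_measure_pmf_iff)
  ultimately show ?thesis
    unfolding wasserstein_def using \<pi>
    by (intro cInf_eq_minimum) (auto intro!: rev_image_eqI antisym)
qed

section \<open>Lazy measures and curvature from a potential\<close>

lemma set_lazy_measure_subset:
  assumes "finite (nbrs E x)" "nbrs E x \<noteq> {}"
  shows "set_pmf (lazy_measure E \<alpha> x) \<subseteq> insert x (nbrs E x)"
  using set_pmf_of_set[OF assms(2,1)] by (auto simp: lazy_measure_def split: if_splits)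

lemma expectation_lazy_measure:
  fixes f :: "'a \<Rightarrow> real"
  assumes "\<alpha> \<in> {0..1}" "finite (nbrs E x)" "nbrs E x \<noteq> {}" "{x} \<notin> E"
  shows "measure_pmf.expectation (lazy_measure E \<alpha> x) f =
    \<alpha> * f x + (1 - \<alpha>) * ((\<Sum>z\<in>nbrs E x. f z) / degree E x)"
proof -
  have x: "x \<notin> nbrs E x" using assms(4) by (simp add: nbrs_def)
  have "measure_pmf.expectation (lazy_measure E \<alpha> x) f =
      (\<Sum>z\<in>insert x (nbrs E x). f z * pmf (lazy_measure E \<alpha> x) z)"
    using assms set_lazy_measure_subset[of E x \<alpha>] by (intro integral_measure_pmf_real) auto
  also have "\<dots> = \<alpha> * f x + (\<Sum>z\<in>nbrs E x. f z * ((1 - \<alpha>) / degree E x))"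
    using assms x by (auto simp: pmf_lazy_measure nbrs_def intro!: sum.cong)
  finally show ?thesis unfolding sum_distrib_right[symmetric] by simp
qed

text \<open>The idle mass is split so that \<open>y\<close> carries the same share as each neighbour
  and the excess \<beta> sits at \<open>y\<close> alone. The bound \<alpha> \<ge> 1/2 keeps \<beta>
  nonnegative for every degree.\<close>

lemma lazy_measure_closed_nbrs:
  assumes "\<alpha> \<in> {1/2..1}" "finite (nbrs E y)" "nbrs E y \<noteq> {}" "{y} \<notin> E"
  defines "\<beta> \<equiv> \<alpha> - (1 - \<alpha>) / degree E y"
  shows "lazy_measure E \<alpha> y = bind_pmf (bernoulli_pmf \<beta>)
    (\<lambda>b. if b then return_pmf y else pmf_of_set (insert y (nbrs E y)))"
    and "\<beta> \<in> {0..1}"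
    and "(1 - \<beta>) / (degree E y + 1) = (1 - \<alpha>) / degree E y"
proof -
  have D: "degree E y \<ge> 1" using assms by (simp add: degree_def Suc_le_eq card_gt_0_iff)
  have "(1 - \<alpha>) / degree E y \<le> (1 - \<alpha>) / 1"
    using D assms(1) by (intro divide_left_mono) auto
  moreover have "0 \<le> (1 - \<alpha>) / degree E y" using assms(1) by simp
  ultimately show \<beta>: "\<beta> \<in> {0..1}" using assms(1) by (auto simp: \<beta>_def)
  show eq: "(1 - \<beta>) / (degree E y + 1) = (1 - \<alpha>) / degree E y"
  proof -
    have "1 - \<beta> = (1 - \<alpha>) / degree E y * (degree E y + 1)"
      using D by (simp add: \<beta>_def distrib_left)
    then show ?thesis by simp
  qed
  have "y \<notin> nbrs E y" using assms(4) by (simp add: nbrs_def)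
  then have "card (insert y (nbrs E y)) = degree E y + 1"
    using assms(2) by (simp add: degree_def)
  then have "pmf (bind_pmf (bernoulli_pmf \<beta>)
      (\<lambda>b. if b then return_pmf y else pmf_of_set (insert y (nbrs E y)))) u =
      \<beta> * (if u = y then 1 else 0) +
      (1 - \<beta>) / (degree E y + 1) * (if u \<in> insert y (nbrs E y) then 1 else 0)" for u
    using assms(2) \<beta> by (simp add: pmf_bind integral_bernoulli_pmf indicator_def)
  then show "lazy_measure E \<alpha> y = bind_pmf (bernoulli_pmf \<beta>)
      (\<lambda>b. if b then return_pmf y else pmf_of_set (insert y (nbrs E y)))"
    unfolding eq using assms by (intro pmf_eqI) (auto simp: pmf_lazy_measure \<beta>_def nbrs_def)
qed

text \<open>A weighted edge may be longer than a detour; a potential that drops by the full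
  \<open>w {x, y}\<close> excludes this.\<close>

lemma graph_dist_edge:
  assumes "{x, y} \<in> E" "x \<noteq> y" and "\<And>e. e \<in> E \<Longrightarrow> 0 \<le> w e"
    and "\<And>u v. {u, v} \<in> E \<Longrightarrow> f u - f v \<le> w {u, v}" and "f x - f y = w {x, y}"
  shows "graph_dist E w x y = w {x, y}"
proof -
  have p: "is_path E x y [x, y]" using assms(1,2) by (simp add: is_path_def)
  show ?thesis
    using graph_dist_le_path_weight[OF p, of w] graph_dist_ge_diff[OF p, of f w] assms(3-5)
    by (intro antisym) auto
qed

text \<open>
  A potential \<open>f\<close> and a coupling supported on pairs along which \<open>f\<close> realises the distance
  certify the transport cost for every idleness close to 1, where it is affine in \<open>\<alpha>\<close>.
\<close>

lemma has_LLY_curvature_potential: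
  fixes f :: "'a \<Rightarrow> real"
  assumes G: "finite_connected_simple_graph V E" and pos: "\<And>e. e \<in> E \<Longrightarrow> 0 < w e"
    and xy: "{x, y} \<in> E"
    and lip: "\<And>u v. {u, v} \<in> E \<Longrightarrow> f u - f v \<le> w {u, v}"
    and fxy: "f x - f y = w {x, y}"
    and cpl: "\<And>\<alpha>. \<alpha> \<in> {1/2..1} \<Longrightarrow> \<exists>\<pi>\<in>couplings (lazy_measure E \<alpha> x) (lazy_measure E \<alpha> y).
      \<forall>(u, v)\<in>set_pmf \<pi>. \<exists>p. is_path E u v p \<and> path_weight w p \<le> f u - f v"
  shows "has_LLY_curvature E w x y
    (1 - ((\<Sum>z\<in>nbrs E x. f z) / degree E x - (\<Sum>z\<in>nbrs E y. f z) / degree E y) / w {x, y})"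
    (is "has_LLY_curvature E w x y (1 - ?D / _)")
proof -
  have E: "e \<subseteq> V" "card e = 2" if "e \<in> E" for e
    using G that by (auto simp: finite_connected_simple_graph_def)
  have loop: "{u} \<notin> E" for u using E(2)[of "{u}"] by auto
  have nV: "insert u (nbrs E u) \<subseteq> V" if "u \<in> V" for u
    using E(1) that by (auto simp: nbrs_def)
  have V: "x \<in> V" "y \<in> V" using E(1)[OF xy] by auto
  have fin: "finite (nbrs E u)" if "u \<in> V" for u
    using nV[OF that] G by (auto simp: finite_connected_simple_graph_def intro: finite_subset)
  have ne: "nbrs E x \<noteq> {}" "nbrs E y \<noteq> {}"
    using xy by (auto simp: nbrs_def insert_commute)
  have supp: "set_pmf (lazy_measure E \<alpha> x) \<subseteq> V" "set_pmf (lazy_measure E \<alpha> y) \<subseteq> V" for \<alpha>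
    using set_lazy_measure_subset nV fin ne V by (metis order_trans)+
  have wxy: "w {x, y} > 0" using pos xy by blast
  have dist: "graph_dist E w x y = w {x, y}"
    using xy loop lip fxy pos by (intro graph_dist_edge[where f = f]) (auto intro: less_imp_le)
  \<comment> \<open>Both expectations of \<open>f\<close> are affine in \<alpha>: the idle mass
    contributes \<open>f x - f y\<close>, the moving mass the difference of the neighbour
    means.\<close>
  have W: "wasserstein (graph_dist E w) (lazy_measure E \<alpha> x) (lazy_measure E \<alpha> y)
      = \<alpha> * w {x, y} + (1 - \<alpha>) * ?D" if \<alpha>: "\<alpha> \<in> {1/2..1}" for \<alpha>
  proof -
    obtain \<pi> where \<pi>: "\<pi> \<in> couplings (lazy_measure E \<alpha> x) (lazy_measure E \<alpha> y)"
      "\<And>u v. (u, v) \<in> set_pmf \<pi> \<Longrightarrow> \<exists>p. is_path E u v p \<and> path_weight w p \<le> f u - f v"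
      using cpl[OF \<alpha>] by fast
    have "wasserstein (graph_dist E w) (lazy_measure E \<alpha> x) (lazy_measure E \<alpha> y) =
        measure_pmf.expectation (lazy_measure E \<alpha> x) f -
        measure_pmf.expectation (lazy_measure E \<alpha> y) f"
    proof (rule wasserstein_eqI[OF _ _ _ \<pi>(1)])
      show "finite (set_pmf (lazy_measure E \<alpha> x))" "finite (set_pmf (lazy_measure E \<alpha> y))"
        using supp G by (meson finite_connected_simple_graph_def finite_subset)+
    next
      fix u v assume "u \<in> set_pmf (lazy_measure E \<alpha> x)" "v \<in> set_pmf (lazy_measure E \<alpha> y)"
      then obtain p where "is_path E u v p"
        using supp G unfolding finite_connected_simple_graph_def by (meson subsetD)
      then show "f u - f v \<le> graph_dist E w u v" using lip by (rule graph_dist_ge_diff)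
    next
      fix u v assume "(u, v) \<in> set_pmf \<pi>"
      then obtain p where "is_path E u v p" "path_weight w p \<le> f u - f v" using \<pi>(2) by blast
      then show "graph_dist E w u v \<le> f u - f v"
        using graph_dist_le_path_weight[of E u v p w] pos by (force intro: less_imp_le)
    qed
    also have "\<dots> = \<alpha> * (f x - f y) + (1 - \<alpha>) * ?D"
      using \<alpha> fin V ne loop by (simp add: expectation_lazy_measure algebra_simps)
    finally show ?thesis by (simp add: fxy)
  qed
  \<comment> \<open>For these idlenesses the quotient in the definition is constant, so the limit is
    this constant.\<close>
  have "eventually (\<lambda>\<alpha>. \<alpha> \<in> {1/2<..<1::real}) (at_left 1)"
    by (rule eventually_at_leftI[of "1/2"]) auto
  then have "eventually (\<lambda>\<alpha>. lazy_curvature E w \<alpha> x y / (1 - \<alpha>) = 1 - ?D / w {x, y}) (at_left 1)"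
  proof eventually_elim
    case (elim \<alpha>)
    have "lazy_curvature E w \<alpha> x y = (1 - \<alpha>) * (1 - ?D / w {x, y})"
      using W[of \<alpha>] elim wxy by (simp add: lazy_curvature_def dist field_simps)
    then show ?case using elim by simp
  qed
  then show ?thesis
    unfolding has_LLY_curvature_def by (rule tendsto_eventually)
qed

text \<open>
  The coupling leaves mass \<open>\<beta>\<close> on the pair \<open>(x, y)\<close> and transports the rest along \<open>\<psi>\<close>,
  backwards from the closed neighbourhood of \<open>y\<close>.
\<close>

lemma lazy_measure_couplingI:
  assumes "\<alpha> \<in> {1/2..1}" "finite (nbrs E y)" "nbrs E y \<noteq> {}" "{y} \<notin> E"
  defines "\<beta> \<equiv> \<alpha> - (1 - \<alpha>) / degree E y"
  assumes x: "lazy_measure E \<alpha> x = bind_pmf (bernoulli_pmf \<beta>)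
    (\<lambda>b. if b then return_pmf x else map_pmf \<psi> (pmf_of_set (insert y (nbrs E y))))"
    and "P (x, y)" and "\<And>v. v \<in> insert y (nbrs E y) \<Longrightarrow> P (\<psi> v, v)"
  shows "\<exists>\<pi>\<in>couplings (lazy_measure E \<alpha> x) (lazy_measure E \<alpha> y). \<forall>uv\<in>set_pmf \<pi>. P uv"
proof (intro bexI ballI)
  let ?\<pi> = "bind_pmf (bernoulli_pmf \<beta>) (\<lambda>b. if b then return_pmf (x, y)
    else map_pmf (\<lambda>v. (\<psi> v, v)) (pmf_of_set (insert y (nbrs E y))))"
  show "?\<pi> \<in> couplings (lazy_measure E \<alpha> x) (lazy_measure E \<alpha> y)"
    unfolding couplings_def x lazy_measure_closed_nbrs(1)[OF assms(1-4), folded \<beta>_def]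
    by (auto simp: map_bind_pmf if_distrib[of "map_pmf _"] map_pmf_comp intro!: bind_pmf_cong)
  fix uv assume "uv \<in> set_pmf ?\<pi>"
  then show "P uv"
    using set_pmf_of_set[of "insert y (nbrs E y)"] assms by (auto split: if_splits)
qed

section \<open>The largest eigenvalue and the rows of the Ricci matrix\<close>

lemma eigenvalue_on_le:
  assumes "finite I" and nonneg: "\<And>i j. i \<in> I \<Longrightarrow> j \<in> I \<Longrightarrow> i \<noteq> j \<Longrightarrow> 0 \<le> A i j"
    and w: "eigenvector_on I A w r" and pos: "\<And>i. i \<in> I \<Longrightarrow> 0 < w i"
    and "eigenvalue_on I A c"
  shows "c \<le> r"
proof -
  obtain v where v: "eigenvector_on I A v c" using assms(5) by (auto simp: eigenvalue_on_def)
  then have I: "I \<noteq> {}" by (auto simp: eigenvector_on_def)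
  \<comment> \<open>Diagonal entries may be negative; moving them to the other side leaves a sum
    with nonnegative coefficients.\<close>
  have off: "(\<Sum>j\<in>I - {i}. A i j * u j) = (k - A i i) * u i"
    if "eigenvector_on I A u k" "i \<in> I" for u k i
    using that \<open>finite I\<close> by (auto simp: eigenvector_on_def sum.remove[of I i] algebra_simps)
  \<comment> \<open>The least \<open>t\<close> for which \<open>t * w\<close> dominates the absolute
    values of \<open>v\<close>; domination is an equality at the index \<open>i\<close> where the
    maximum is attained.\<close>
  define t where "t = Max ((\<lambda>i. \<bar>v i\<bar> / w i) ` I)"
  have t: "\<bar>v i\<bar> \<le> t * w i" if "i \<in> I" for i
    using that pos[OF that] \<open>finite I\<close> by (simp add: t_def flip: pos_divide_le_eq)
  obtain i where i: "i \<in> I" "t = \<bar>v i\<bar> / w i"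
    using Max_in[of "(\<lambda>i. \<bar>v i\<bar> / w i) ` I"] \<open>finite I\<close> I unfolding t_def by fast
  obtain j where j: "j \<in> I" "v j \<noteq> 0" using v by (auto simp: eigenvector_on_def)
  have "0 < t * w j" using t[OF j(1)] j(2) by simp
  then have "0 < t" using pos[OF j(1)] by (simp add: zero_less_mult_iff)
  then have vi: "\<bar>v i\<bar> = t * w i" "0 < \<bar>v i\<bar>" using i pos[OF i(1)] by (auto simp: field_simps)
  \<comment> \<open>Row \<open>i\<close> of \<open>v\<close> is bounded by \<open>t\<close> times
    row \<open>i\<close> of \<open>w\<close>, and both sides are multiples of the same positive
    number.\<close>
  have "(c - A i i) * \<bar>v i\<bar> \<le> \<bar>(c - A i i) * v i\<bar>" by (simp add: abs_mult mult_right_mono)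
  also have "\<dots> = \<bar>\<Sum>j\<in>I - {i}. A i j * v j\<bar>" by (simp add: off[OF v i(1)])
  also have "\<dots> \<le> (\<Sum>j\<in>I - {i}. \<bar>A i j * v j\<bar>)" by (rule sum_abs)
  also have "\<dots> \<le> (\<Sum>j\<in>I - {i}. A i j * (t * w j))"
    using nonneg[OF i(1)] t by (intro sum_mono) (auto simp: abs_mult intro!: mult_left_mono)
  also have "\<dots> = t * (\<Sum>j\<in>I - {i}. A i j * w j)"
    by (simp add: sum_distrib_left mult.left_commute)
  also have "\<dots> = (r - A i i) * \<bar>v i\<bar>" by (simp add: off[OF w i(1)] vi)
  finally show ?thesis using vi(2) by simp
qed

lemma lambda_max_eq:
  assumes "finite I" and "\<And>i j. i \<in> I \<Longrightarrow> j \<in> I \<Longrightarrow> i \<noteq> j \<Longrightarrow> 0 \<le> A i j"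
    and "eigenvector_on I A w r" and "\<And>i. i \<in> I \<Longrightarrow> 0 < w i"
  shows "lambda_max I A = r"
  unfolding lambda_max_def
  using assms eigenvalue_on_le[OF assms] by (intro Greatest_equality) (auto simp: eigenvalue_on_def)

text \<open>Sorting the edges that meet \<open>{x, y}\<close> by shared endpoint gives star sums. A
  star counts the edge itself with +1/degree where the matrix has -1/degree, hence the correction by
  twice its value.\<close>

lemma sum_ricci_matrix:
  fixes v :: "'a set \<Rightarrow> real"
  assumes E: "finite E" "\<And>e. e \<in> E \<Longrightarrow> card e = 2" and xy: "{x, y} \<in> E"
  defines "S \<equiv> \<lambda>z. (\<Sum>u\<in>nbrs E z. v {z, u})"
  shows "(\<Sum>e\<in>E. ricci_matrix E {x, y} e * v e) =
    (S x - 2 * v {x, y}) / degree E x + (S y - 2 * v {x, y}) / degree E y"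
proof -
  let ?D = "\<lambda>z. 1 / real (degree E z)"
  have "x \<noteq> y" using E(2)[OF xy] by auto
  have ricci: "ricci_matrix E {x, y} e = (\<Sum>z\<in>{x, y}. if z \<in> e then ?D z else 0) -
      (if e = {x, y} then 2 * (\<Sum>z\<in>{x, y}. ?D z) else 0)" for e
    by (simp add: ricci_matrix_def sum.inter_filter flip: sum.inter_restrict)
  have "(\<Sum>e\<in>E. ricci_matrix E {x, y} e * v e) =
      (\<Sum>e\<in>E. \<Sum>z\<in>{x, y}. (if z \<in> e then ?D z else 0) * v e) -
      (\<Sum>e\<in>E. if e = {x, y} then 2 * (\<Sum>z\<in>{x, y}. ?D z) * v e else 0)"
    unfolding sum_subtractf[symmetric] ricci
    by (intro sum.cong refl) (auto simp: left_diff_distrib sum_distrib_right distrib_right)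
  also have "(\<Sum>e\<in>E. if e = {x, y} then 2 * (\<Sum>z\<in>{x, y}. ?D z) * v e else 0) =
      2 * (\<Sum>z\<in>{x, y}. ?D z) * v {x, y}"
    using E(1) xy by simp
  also have "(\<Sum>e\<in>E. \<Sum>z\<in>{x, y}. (if z \<in> e then ?D z else 0) * v e) = (\<Sum>z\<in>{x, y}. ?D z * S z)"
    unfolding sum.swap[of _ _ E]
  proof (rule sum.cong[OF refl])
    fix z
    \<comment> \<open>Neighbours of \<open>z\<close> correspond to edges through \<open>z\<close>,
      since every edge has two elements.\<close>
    have "inj_on (\<lambda>u. {z, u}) (nbrs E z)" by (auto simp: inj_on_def doubleton_eq_iff)
    moreover have "(\<lambda>u. {z, u}) ` nbrs E z = {e \<in> E. z \<in> e}"
      using E(2) by (fastforce simp: nbrs_def card_2_iff insert_commute)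
    ultimately have "S z = sum v {e \<in> E. z \<in> e}"
      unfolding S_def by (metis (mono_tags, lifting) sum.reindex_cong)
    then have "S z = (\<Sum>e\<in>E. if z \<in> e then v e else 0)"
      using E(1) by (simp add: sum.inter_filter)
    then show "(\<Sum>e\<in>E. (if z \<in> e then ?D z else 0) * v e) = ?D z * S z"
      by (simp only: sum_distrib_left) (rule sum.cong, auto)
  qed
  finally show ?thesis using \<open>x \<noteq> y\<close> by (simp add: algebra_simps diff_divide_distrib)
qed

section \<open>Harmonic functions on a cycle\<close>

lemma cyclic_pred_succ: "i < g \<Longrightarrow> Suc ((i + g - 1) mod g) mod g = i" for i g :: nat
  by (simp add: mod_simps Suc_diff_le)

lemma cyclic_succ_pred: "i < g \<Longrightarrow> (Suc i mod g + g - 1) mod g = i" for i g :: nat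
  by (cases "Suc i = g") (auto simp: mod_if)

text \<open>Minimum principle: where \<open>f\<close> is minimal, both neighbours average to the
  minimum and so attain it; stepping forward carries this around the cycle.\<close>

lemma cyclic_harmonic_const:
  fixes f :: "nat \<Rightarrow> real"
  assumes harm: "\<And>i. i < g \<Longrightarrow> 2 * f i = f ((i + g - 1) mod g) + f (Suc i mod g)" and "i < g"
  shows "f i = f 0"
proof -
  have fin: "finite (f ` {..<g})" "f ` {..<g} \<noteq> {}" using assms(2) by auto
  obtain m where m: "m < g" "f m = Min (f ` {..<g})" using Min_in[OF fin] by fastforce
  have min: "f m \<le> f k" if "k < g" for k using m(2) that fin by simp
  have "f ((m + k) mod g) = f m" for k
  proof (induction k)
    case 0
    then show ?case using m by simp
  next
    case (Suc k)
    let ?j = "(m + k) mod g"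
    have "?j < g" "(?j + g - 1) mod g < g" "Suc ?j mod g < g" using m by auto
    then have "f (Suc ?j mod g) = f m"
      using harm[of ?j] min[of "(?j + g - 1) mod g"] min[of "Suc ?j mod g"] Suc by linarith
    then show ?case by (simp add: mod_simps)
  qed
  note from_m = this
  have const: "f k = f m" if "k < g" for k
  proof -
    \<comment> \<open>Going \<open>k + (g - m)\<close> steps forward from \<open>m\<close> ends at
      \<open>k\<close>; the extra turn by \<open>g\<close> avoids a negative step count.\<close>
    have "m + (k + (g - m)) = k + g" using m(1) by simp
    then show ?thesis using from_m[of "k + (g - m)"] that by simp
  qed
  then show ?thesis using const[of i] const[of 0] assms(2) by simp
qed

section \<open>The sun graph and its Perron eigenvector\<close>

lemma sun_edgesI:
  "i < g \<Longrightarrow> {Cyc i, Cyc (Suc i mod g)} \<in> sun_edges g d"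
  "i < g \<Longrightarrow> j < d - 2 \<Longrightarrow> {Cyc i, Leaf i j} \<in> sun_edges g d"
  by (auto simp: sun_edges_def)

lemma sun_edgesE:
  assumes "e \<in> sun_edges g d"
  obtains i where "i < g" "e = {Cyc i, Cyc (Suc i mod g)}"
    | i j where "i < g" "j < d - 2" "e = {Cyc i, Leaf i j}"
  using assms by (auto simp: sun_edges_def)

lemma nbrs_sun_Leaf:
  assumes "i < g" "j < d - 2"
  shows "nbrs (sun_edges g d) (Leaf i j) = {Cyc i}"
  using assms by (auto simp: nbrs_def sun_edges_def doubleton_eq_iff)

lemma sum_nbrs_sun_Cyc:
  fixes f :: "sun_vertex \<Rightarrow> real"
  assumes "g \<ge> 3" "i < g"
  shows "(\<Sum>u\<in>nbrs (sun_edges g d) (Cyc i). f u) =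
    f (Cyc ((i + g - 1) mod g)) + f (Cyc (Suc i mod g)) + (\<Sum>j<d - 2. f (Leaf i j))"
proof -
  have ne: "Suc i mod g \<noteq> (i + g - 1) mod g"
    using assms by (cases "Suc i = g"; cases i) (auto simp: mod_if)
  have "(\<Sum>u\<in>nbrs (sun_edges g d) (Cyc i). f u) =
      (\<Sum>u\<in>{Cyc (Suc i mod g), Cyc ((i + g - 1) mod g)}. f u) + (\<Sum>u\<in>Leaf i ` {..<d - 2}. f u)"
    unfolding nbrs_sun_Cyc[OF assms] by (rule sum.union_disjoint) auto
  then show ?thesis using ne by (simp add: sum.reindex inj_on_def)
qed

lemma sun_edges_simple:
  assumes "g \<ge> 3"
  shows "finite (sun_edges g d)" and "e \<in> sun_edges g d \<Longrightarrow> card e = 2"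
proof -
  note G = finite_connected_simple_graph_sun[OF assms, of d]
  have "sun_edges g d \<subseteq> Pow (sun_verts g d)"
    using G by (auto simp: finite_connected_simple_graph_def)
  then show "finite (sun_edges g d)"
    using G by (auto simp: finite_connected_simple_graph_def intro: finite_subset)
  show "e \<in> sun_edges g d \<Longrightarrow> card e = 2"
    using G by (auto simp: finite_connected_simple_graph_def)
qed

text \<open>The predecessor comes first so that \<open>cyclic_pred_succ\<close> brings this edge
  into the standard form of a cycle edge.\<close>

definition sun_star :: "nat \<Rightarrow> nat \<Rightarrow> (sun_vertex set \<Rightarrow> real) \<Rightarrow> nat \<Rightarrow> real" where
  "sun_star g d v i = v {Cyc ((i + g - 1) mod g), Cyc i} + v {Cyc i, Cyc (Suc i mod g)} +
    (\<Sum>j<d - 2. v {Cyc i, Leaf i j})"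

text \<open>The leaf end has degree 1 and its star is the edge itself, so it contributes minus the
  edge value; over the denominator \<open>d\<close> this turns the coefficient 2 into
  \<open>d + 2\<close>.\<close>

lemma sum_ricci_matrix_sun:
  assumes "g \<ge> 3" "d \<ge> 2" "i < g"
  shows "(\<Sum>e\<in>sun_edges g d. ricci_matrix (sun_edges g d) {Cyc i, Cyc (Suc i mod g)} e * v e) =
      (sun_star g d v i + sun_star g d v (Suc i mod g) - 4 * v {Cyc i, Cyc (Suc i mod g)}) / d"
    and "j < d - 2 \<Longrightarrow>
      (\<Sum>e\<in>sun_edges g d. ricci_matrix (sun_edges g d) {Cyc i, Leaf i j} e * v e) =
      (sun_star g d v i - (real d + 2) * v {Cyc i, Leaf i j}) / d"
proof -
  have star: "(\<Sum>u\<in>nbrs (sun_edges g d) (Cyc k). v {Cyc k, u}) = sun_star g d v k" if "k < g" for k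
    using sum_nbrs_sun_Cyc[OF assms(1) that] by (simp add: sun_star_def insert_commute)
  note ricci = sum_ricci_matrix[OF sun_edges_simple[OF assms(1)]]
  show "(\<Sum>e\<in>sun_edges g d. ricci_matrix (sun_edges g d) {Cyc i, Cyc (Suc i mod g)} e * v e) =
      (sun_star g d v i + sun_star g d v (Suc i mod g) - 4 * v {Cyc i, Cyc (Suc i mod g)}) / d"
    using assms
    by (simp add: ricci sun_edgesI star degree_sun_Cyc add_divide_distrib diff_divide_distrib)
  show "(\<Sum>e\<in>sun_edges g d. ricci_matrix (sun_edges g d) {Cyc i, Leaf i j} e * v e) =
      (sun_star g d v i - (real d + 2) * v {Cyc i, Leaf i j}) / d" if "j < d - 2"
  proof -
    have "(\<Sum>e\<in>sun_edges g d. ricci_matrix (sun_edges g d) {Cyc i, Leaf i j} e * v e) =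
        (sun_star g d v i - 2 * v {Cyc i, Leaf i j}) / d - v {Cyc i, Leaf i j}"
      using assms that
      by (simp add: ricci sun_edgesI star degree_sun_Cyc degree_sun_Leaf nbrs_sun_Leaf
          insert_commute[of "Leaf i j"])
    also have "\<dots> = (sun_star g d v i - (real d + 2) * v {Cyc i, Leaf i j}) / d"
      using assms(2) by (simp add: field_simps)
    finally show ?thesis .
  qed
qed

text \<open>As \<open>d - 1\<close> is the square of \<open>s\<close>, every star sum is 2 (1 + s) +
  (d - 2) = (1 + s)^2. Both kinds of rows then give the factor 2 (s - 1) / d.\<close>

lemma sun_eigenvector_exists:
  assumes "d \<ge> 3" "g \<ge> 3"
  defines "s \<equiv> sqrt (real d - 1)"
  shows "eigenvector_on (sun_edges g d) (ricci_matrix (sun_edges g d))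
    (\<lambda>e. if e \<subseteq> range Cyc then 1 + s else 1) (2 * (s - 1) / d)"
    (is "eigenvector_on ?E _ ?v ?c")
proof -
  have s: "s\<^sup>2 = real d - 1" "s \<ge> 0" using assms by (auto simp: s_def)
  have v: "?v {Cyc i, Cyc k} = 1 + s" "?v {Cyc i, Leaf i j} = 1" for i j k by auto
  have star: "sun_star g d ?v i = (1 + s)\<^sup>2" for i
    unfolding sun_star_def v using s assms(1) by (simp add: power2_eq_square of_nat_diff algebra_simps)
  have "(\<Sum>e'\<in>?E. ricci_matrix ?E e e' * ?v e') = ?c * ?v e" if "e \<in> ?E" for e
    using that
  proof (cases rule: sun_edgesE)
    case (1 i)
    show ?thesis unfolding 1(2)
      using sum_ricci_matrix_sun(1)[of g d i ?v] 1(1) assms(1,2) star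
      by (simp add: power2_eq_square algebra_simps)
  next
    case (2 i j)
    have "(1 + s)\<^sup>2 - (real d + 2) = 2 * (s - 1)" using s by (simp add: power2_eq_square algebra_simps)
    then show ?thesis unfolding 2(3)
      using sum_ricci_matrix_sun(2)[of g d i j ?v] 2(1,2) assms(1,2) star
      by (simp add: image_iff)
  qed
  moreover have "{Cyc 0, Cyc (Suc 0 mod g)} \<in> ?E" using assms by (intro sun_edgesI) auto
  ultimately show ?thesis
    unfolding eigenvector_on_def using s(2) by (intro conjI bexI[of _ "{Cyc 0, Cyc (Suc 0 mod g)}"]) auto
qed

text \<open>The Einstein claim concerns every positive eigenvector, so the weights have to be known
  up to scale.\<close>

lemma sun_eigenvector_unique:
  assumes "d \<ge> 3" "g \<ge> 3"
  defines "s \<equiv> sqrt (real d - 1)"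
  assumes v: "eigenvector_on (sun_edges g d) (ricci_matrix (sun_edges g d)) v (2 * (s - 1) / d)"
  obtains a where "\<And>i. i < g \<Longrightarrow> v {Cyc i, Cyc (Suc i mod g)} = (1 + s) * a"
    and "\<And>i j. i < g \<Longrightarrow> j < d - 2 \<Longrightarrow> v {Cyc i, Leaf i j} = a"
proof -
  have s: "s\<^sup>2 = real d - 1" "s \<ge> 0" using assms by (auto simp: s_def)
  let ?S = "sun_star g d v" and ?x = "\<lambda>i. v {Cyc i, Cyc (Suc i mod g)}"
  have eig: "(\<Sum>e'\<in>sun_edges g d. ricci_matrix (sun_edges g d) e e' * v e') = 2 * (s - 1) / d * v e"
    if "e \<in> sun_edges g d" for e
    using v that by (auto simp: eigenvector_on_def)
  have cyc: "2 * (s + 1) * ?x i = ?S i + ?S (Suc i mod g)" if "i < g" for i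
  proof -
    have "(?S i + ?S (Suc i mod g) - 4 * ?x i) / d = 2 * (s - 1) / d * ?x i"
      using eig[OF sun_edgesI(1)[OF that]] sum_ricci_matrix_sun(1)[of g d i v] that assms(1,2) by simp
    then show ?thesis using assms(1) by (simp add: field_simps)
  qed
  have leaf: "(s + 1)\<^sup>2 * v {Cyc i, Leaf i j} = ?S i" if "i < g" "j < d - 2" for i j
  proof -
    have "(?S i - (real d + 2) * v {Cyc i, Leaf i j}) / d = 2 * (s - 1) / d * v {Cyc i, Leaf i j}"
      using eig[OF sun_edgesI(2)[OF that]] sum_ricci_matrix_sun(2)[of g d i j v] that assms(1,2) by simp
    then have "?S i = (2 * (s - 1) + (real d - 1) + 3) * v {Cyc i, Leaf i j}"
      using assms(1) by (simp add: field_simps)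
    then show ?thesis by (simp add: power2_eq_square algebra_simps flip: s(1))
  qed
  \<comment> \<open>Leaf weights are replaced by multiples of the star sum. They make up the
    fraction (s - 1) / (s + 1) of it, which leaves 2 / (s + 1) for the two cycle edges.\<close>
  have S: "2 * ?S i = (s + 1) * (?x ((i + g - 1) mod g) + ?x i)" if "i < g" for i
  proof -
    have "(\<Sum>j<d - 2. v {Cyc i, Leaf i j}) = (\<Sum>j<d - 2. ?S i / (s + 1)\<^sup>2)"
      using leaf[OF that] s(2) by (intro sum.cong) (auto simp: field_simps)
    also have "\<dots> = (s\<^sup>2 - 1) * (?S i / (s + 1)\<^sup>2)" using s(1) assms(1) by (simp add: of_nat_diff)
    also have "(s\<^sup>2 - 1) * (?S i / (s + 1)\<^sup>2) = (s - 1) / (s + 1) * ?S i"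
    proof -
      have "s\<^sup>2 - 1 = (s - 1) * (s + 1)" by (simp add: power2_eq_square algebra_simps)
      then show ?thesis using s(2) by (simp add: power2_eq_square)
    qed
    finally have "?S i = ?x ((i + g - 1) mod g) + ?x i + (s - 1) / (s + 1) * ?S i"
      using that by (subst sun_star_def) (simp add: cyclic_pred_succ del: One_nat_def)
    then show ?thesis using s(2) by (simp add: field_simps)
  qed
  \<comment> \<open>Doubling \<open>cyc\<close> allows \<open>S\<close> to be inserted at both
    endpoints; cancelling \<open>s + 1\<close> leaves the mean value property.\<close>
  have "2 * ?x i = ?x ((i + g - 1) mod g) + ?x (Suc i mod g)" if "i < g" for i
  proof -
    have "4 * (s + 1) * ?x i = 2 * (2 * (s + 1) * ?x i)" by simp
    also have "\<dots> = 2 * ?S i + 2 * ?S (Suc i mod g)" unfolding cyc[OF that] by simp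
    also have "2 * ?S (Suc i mod g) = (s + 1) * (?x i + ?x (Suc i mod g))"
      using S[of "Suc i mod g"] that unfolding cyclic_succ_pred[OF that] by simp
    also have "2 * ?S i + \<dots> = (s + 1) * (?x ((i + g - 1) mod g) + 2 * ?x i + ?x (Suc i mod g))"
      using S[OF that] by (simp add: algebra_simps)
    finally have "(s + 1) * (4 * ?x i) =
        (s + 1) * (?x ((i + g - 1) mod g) + 2 * ?x i + ?x (Suc i mod g))"
      by (simp only: mult_ac)
    then have "4 * ?x i = ?x ((i + g - 1) mod g) + 2 * ?x i + ?x (Suc i mod g)"
      using s(2) by (subst (asm) mult_cancel_left) auto
    then show ?thesis by simp
  qed
  note harmonic = this
  define x where "x = ?x 0"
  have const: "?x i = x" if "i < g" for i
    unfolding x_def by (rule cyclic_harmonic_const[of g ?x, OF harmonic that])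
  show ?thesis
  proof (rule that[of "x / (1 + s)"])
    have ne: "s + 1 \<noteq> 0" using s(2) by simp
    fix i assume i: "i < g"
    show "?x i = (1 + s) * (x / (1 + s))" using const[OF i] s(2) by simp
    fix j assume j: "j < d - 2"
    have "?S i = (s + 1) * x" using S[OF i] i by (simp add: const)
    then have "(s + 1) * ((s + 1) * v {Cyc i, Leaf i j}) = (s + 1) * x"
      using leaf[OF i j] by (simp add: power2_eq_square)
    then have "(s + 1) * v {Cyc i, Leaf i j} = x"
      by (simp only: mult_left_cancel[OF ne])
    then show "v {Cyc i, Leaf i j} = x / (1 + s)"
      using nonzero_mult_div_cancel_left[OF ne, of "v {Cyc i, Leaf i j}"] by (simp only: add.commute)
  qed
qed

section \<open>Curvature of leaf edges and cycle edges\<close>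

lemma sun_leaf_curvature:
  assumes "d \<ge> 3" "g \<ge> 3" "i < g" "j < d - 2"
    and pos: "\<And>e. e \<in> sun_edges g d \<Longrightarrow> 0 < w e"
    and wc: "\<And>i. i < g \<Longrightarrow> w {Cyc i, Cyc (Suc i mod g)} = b"
    and wl: "\<And>i j. i < g \<Longrightarrow> j < d - 2 \<Longrightarrow> w {Cyc i, Leaf i j} = a"
  shows "has_LLY_curvature (sun_edges g d) w (Leaf i j) (Cyc i) ((4 - 2 * (b / a)) / d)"
proof -
  let ?E = "sun_edges g d" and ?x = "Leaf i j" and ?y = "Cyc i"
  \<comment> \<open>Mass flows from \<open>?x\<close> through \<open>?y\<close> to the other
    neighbours of \<open>?y\<close>, so \<open>f\<close> falls by the edge weight on each such edge;
    beyond them it stays at \<open>- b\<close>.\<close>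
  define f where "f v = (if v = ?x then a else if v = ?y then 0
    else if v \<in> range (Leaf i) then - a else - b)" for v
  have a: "a > 0" using pos[OF sun_edgesI(2)[of i g j d]] wl[of i j] assms(3,4) by simp
  have b: "b > 0" using pos[OF sun_edgesI(1)[of i g d]] wc[of i] assms(3) by simp
  have succ: "Suc k mod g \<noteq> k" if "k < g" for k using that assms(2) by (auto simp: mod_if)
  have pred: "(i + g - 1) mod g \<noteq> i" using cyclic_pred_succ[OF assms(3)] succ[OF assms(3)] by metis
  have xy: "{?x, ?y} \<in> ?E" using sun_edgesI(2)[OF assms(3,4)] by (simp add: insert_commute)
  have wxy: "w {?x, ?y} = a" using wl[OF assms(3,4)] by (simp add: insert_commute)
  have wp: "w {?y, Cyc ((i + g - 1) mod g)} = b"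
    using wc[of "(i + g - 1) mod g"] assms(3)
    by (simp add: cyclic_pred_succ insert_commute del: One_nat_def)
  have nx: "nbrs ?E ?x = {?y}" and ny: "degree ?E ?y = d" and dx: "degree ?E ?x = 1"
    using assms by (auto simp: nbrs_sun_Leaf degree_sun_Cyc degree_sun_Leaf)
  note G = finite_connected_simple_graph_sun[OF assms(2), of d]
  have loop: "{u} \<notin> ?E" for u using sun_edges_simple(2)[OF assms(2), of "{u}" d] by auto
  have "has_LLY_curvature ?E w ?x ?y
    (1 - ((\<Sum>z\<in>nbrs ?E ?x. f z) / degree ?E ?x - (\<Sum>z\<in>nbrs ?E ?y. f z) / degree ?E ?y) / w {?x, ?y})"
  proof (rule has_LLY_curvature_potential[OF G pos xy])
    show "f u - f v \<le> w {u, v}" if "{u, v} \<in> ?E" for u v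
      using that
    proof (cases rule: sun_edgesE)
      case (1 k)
      then show ?thesis using wc[of k] b succ[of k] by (auto simp: doubleton_eq_iff f_def insert_commute)
    next
      case (2 k l)
      then show ?thesis using wl[of k l] a by (auto simp: doubleton_eq_iff f_def insert_commute)
    qed
    show "f ?x - f ?y = w {?x, ?y}" by (simp add: wxy f_def)
  next
    fix \<alpha> :: real assume \<alpha>: "\<alpha> \<in> {1/2..1}"
    \<comment> \<open>The share of \<open>?x\<close> stays put and the other \<open>d\<close> shares
      all come from \<open>?y\<close>, the only neighbour of \<open>?x\<close>.\<close>
    let ?N = "insert ?y (nbrs ?E ?y)" and ?\<psi> = "\<lambda>v. if v = ?x then ?x else ?y"
    have N: "finite (nbrs ?E ?y)" "nbrs ?E ?y \<noteq> {}" "?y \<notin> nbrs ?E ?y" "?x \<in> nbrs ?E ?y"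
      using assms(2-4) succ[of i] pred by (auto simp: nbrs_sun_Cyc)
    have card: "card (nbrs ?E ?y) = d" using ny by (simp add: degree_def)
    define \<beta> where "\<beta> = \<alpha> - (1 - \<alpha>) / degree ?E ?y"
    note closed = lazy_measure_closed_nbrs[OF \<alpha> N(1,2) loop, folded \<beta>_def]
    show "\<exists>\<pi>\<in>couplings (lazy_measure ?E \<alpha> ?x) (lazy_measure ?E \<alpha> ?y).
      \<forall>(u, v)\<in>set_pmf \<pi>. \<exists>p. is_path ?E u v p \<and> path_weight w p \<le> f u - f v"
    proof (rule lazy_measure_couplingI[OF \<alpha> N(1,2) loop])
      have pmf: "pmf (map_pmf ?\<psi> (pmf_of_set ?N)) u =
          (if u = ?x then 1 else if u = ?y then d else 0) / (d + 1)" for u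
      proof -
        have "?N \<inter> ?\<psi> -` {u} = (if u = ?x then {?x} else if u = ?y then ?N - {?x} else {})"
          using N by (auto split: if_splits)
        then show ?thesis
          using N card by (simp add: pmf_map measure_pmf_of_set)
      qed
      have "pmf (lazy_measure ?E \<alpha> ?x) u = pmf (bind_pmf (bernoulli_pmf \<beta>)
          (\<lambda>b. if b then return_pmf ?x else map_pmf ?\<psi> (pmf_of_set ?N))) u" for u
      proof -
        have e: "(1 - \<beta>) / (real d + 1) = (1 - \<alpha>) / d" using closed(3) by (simp add: ny add.commute)
        have "pmf (bind_pmf (bernoulli_pmf \<beta>)
          (\<lambda>b. if b then return_pmf ?x else map_pmf ?\<psi> (pmf_of_set ?N))) u =
          \<beta> * (if u = ?x then 1 else 0) + (1 - \<beta>) / (real d + 1) * (if u = ?x then 1 else if u = ?y then d else 0)"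
          using closed(2) pmf by (simp add: pmf_bind integral_bernoulli_pmf indicator_def add.commute)
        also have "\<dots> = (if u = ?x then \<alpha> else if u = ?y then 1 - \<alpha> else 0)"
          unfolding e using assms(1) by (simp add: \<beta>_def ny)
        also have "\<dots> = pmf (lazy_measure ?E \<alpha> ?x) u"
        proof -
          have "{?x, u} \<in> ?E \<longleftrightarrow> u = ?y" using nx by (auto simp: nbrs_def)
          then show ?thesis using \<alpha> nx loop dx by (simp add: pmf_lazy_measure)
        qed
        finally show ?thesis ..
      qed
      then show "lazy_measure ?E \<alpha> ?x = bind_pmf (bernoulli_pmf (\<alpha> - (1 - \<alpha>) / degree ?E ?y))
          (\<lambda>b. if b then return_pmf ?x else map_pmf ?\<psi> (pmf_of_set ?N))"
        unfolding \<beta>_def by (rule pmf_eqI)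
      show "case (?x, ?y) of (u, v) \<Rightarrow> \<exists>p. is_path ?E u v p \<and> path_weight w p \<le> f u - f v"
        using xy wxy by (auto intro!: exI[of _ "[?x, ?y]"] simp: is_path_def f_def)
      fix v assume v: "v \<in> ?N"
      show "case (?\<psi> v, v) of (u, v) \<Rightarrow> \<exists>p. is_path ?E u v p \<and> path_weight w p \<le> f u - f v"
      proof (cases "v = ?x \<or> v = ?y")
        case True
        then show ?thesis by (intro case_prodI exI[of _ "[v]"]) (auto simp: is_path_def)
      next
        case False
        then have "v \<in> nbrs ?E ?y" using v by simp
        then have "{?y, v} \<in> ?E" "w {?y, v} \<le> - f v"
          subgoal by (simp add: nbrs_def)
          using \<open>v \<in> nbrs ?E ?y\<close> assms(2-4) False wl wc[of i] wp
          by (auto simp: nbrs_sun_Cyc f_def simp del: One_nat_def)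
        then show ?thesis using False
          by (intro case_prodI exI[of _ "[?y, v]"]) (auto simp: is_path_def f_def)
      qed
    qed
  qed
  moreover have "(\<Sum>z\<in>nbrs ?E ?y. f z) = - 2 * b + (4 - real d) * a"
  proof -
    \<comment> \<open>All leaves at \<open>?y\<close> have height \<open>- a\<close> except
      \<open>?x\<close>, whose height \<open>a\<close> is written as
      \<open>2 * a - a\<close>.\<close>
    have "(\<Sum>l<d - 2. f (Leaf i l)) = (\<Sum>l<d - 2. (if l = j then 2 * a else 0) - a)"
      by (intro sum.cong) (auto simp: f_def)
    also have "\<dots> = (4 - real d) * a"
      using assms(1,4) by (simp add: sum_subtractf of_nat_diff algebra_simps)
    finally show ?thesis using assms(2,3) succ[of i] pred
      by (simp add: sum_nbrs_sun_Cyc) (simp add: f_def image_iff)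
  qed
  moreover have "1 - (0 - (- 2 * b + (4 - real d) * a) / d) / a = (4 - 2 * (b / a)) / d"
    using a assms(1) by (simp add: field_simps)
  ultimately show ?thesis by (simp add: nx dx ny wxy) (simp add: f_def)
qed

text \<open>The closed neighbourhoods of the endpoints are matched bijectively: the endpoints stay
  fixed, the outer cycle neighbours are matched at cost \<open>3 * b\<close>, and leaves of equal
  index at cost \<open>2 * a + b\<close>.\<close>

lemma sun_cycle_curvature:
  assumes "d \<ge> 3" "g \<ge> 6" "i < g"
    and pos: "\<And>e. e \<in> sun_edges g d \<Longrightarrow> 0 < w e"
    and wc: "\<And>i. i < g \<Longrightarrow> w {Cyc i, Cyc (Suc i mod g)} = b"
    and wl: "\<And>i j. i < g \<Longrightarrow> j < d - 2 \<Longrightarrow> w {Cyc i, Leaf i j} = a"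
  shows "has_LLY_curvature (sun_edges g d) w (Cyc i) (Cyc (Suc i mod g))
    (- 2 * (real d - 2) * (a / b) / d)"
proof -
  let ?E = "sun_edges g d" and ?x = "Cyc i" and ?y = "Cyc (Suc i mod g)"
  let ?p = "(i + g - 1) mod g" and ?q = "Suc (Suc i mod g) mod g"
  \<comment> \<open>Positions along the cycle, starting at \<open>?p\<close>; \<open>h\<close> falls from 2 to -1 over three steps and climbs
    back to 2 within the remaining \<open>g - 3\<close>.\<close>
  define r where "r k = (k + (g - i) + 1) mod g" for k
  define h :: "nat \<Rightarrow> real" where "h n = (if n \<le> 3 then 2 - real n else min 2 (real n - 4))" for n
  \<comment> \<open>Raising the leaves at \<open>?x\<close> by \<open>a\<close> and lowering those
    at \<open>?y\<close> makes the route from leaf to leaf tight; all other leaf edges are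
    flat.\<close>
  define f where "f v = (case v of Cyc k \<Rightarrow> b * h (r k)
    | Leaf k j \<Rightarrow> b * h (r k) + (if k = i then a else if k = Suc i mod g then - a else 0))" for v
  have g3: "g \<ge> 3" using assms(2) by simp
  have a: "a > 0" using pos[OF sun_edgesI(2)[of i g 0 d]] wl[of i 0] assms(1,3) by simp
  have b: "b > 0" using pos[OF sun_edgesI(1)[of i g d]] wc[of i] assms(3) by simp
  have pq: "Suc i mod g < g" "?p < g" "?q < g" "Suc ?p mod g = i"
    using assms(3) by (auto simp: cyclic_pred_succ simp del: One_nat_def)
  have r_Suc: "r (Suc k mod g) = Suc (r k) mod g" for k
    unfolding r_def by (metis Suc_eq_plus1 add_Suc mod_Suc_eq mod_add_left_eq)
  have "r i = 1" using assms(2,3) by (simp add: r_def mod_Suc)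
  then have "r (Suc i mod g) = 2" "r ?q = 3" using assms(2) by (simp_all add: r_Suc)
  moreover have "r ?p = 0"
  proof -
    have "Suc (r ?p) mod g = 1" using r_Suc[of ?p] unfolding pq(4) \<open>r i = 1\<close> by simp
    then show ?thesis by (simp add: mod_Suc r_def split: if_splits)
  qed
  ultimately have r: "r ?p = 0" "r i = 1" "r (Suc i mod g) = 2" "r ?q = 3"
    using \<open>r i = 1\<close> by auto
  have h: "h 0 = 2" "h 1 = 1" "h 2 = 0" "h 3 = -1" by (simp_all add: h_def)
  have r_neq: "k \<noteq> l" if "r k \<noteq> r l" for k l using that by auto
  have dist: "?p \<noteq> i" "?p \<noteq> Suc i mod g" "?p \<noteq> ?q" "i \<noteq> Suc i mod g" "i \<noteq> ?q" "Suc i mod g \<noteq> ?q"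
    by ((rule r_neq, simp add: r del: One_nat_def)+)
  \<comment> \<open>The closing edge needs \<open>g \<ge> 6\<close>: it climbs to 2 from min 2 (g -
    5), which must be at least 1.\<close>
  have h_lip: "\<bar>h (Suc n mod g) - h n\<bar> \<le> 1" if "n < g" for n
  proof (cases "Suc n = g")
    case True
    then have "h n = min 2 (real g - 5)" using assms(2) by (simp add: h_def)
    then show ?thesis using True assms(2) by (simp add: h(1))
  next
    case False
    then have "Suc n mod g = Suc n" using that by simp
    then show ?thesis by (auto simp: h_def min_def)
  qed
  have xy: "{?x, ?y} \<in> ?E" and py: "{Cyc ?p, ?x} \<in> ?E" and yq: "{?y, Cyc ?q} \<in> ?E"
    using sun_edgesI(1)[of i g d] sun_edgesI(1)[of ?p g d] sun_edgesI(1)[of "Suc i mod g" g d] pq assms(3)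
    by auto
  have wxy: "w {?x, ?y} = b" and wpx: "w {Cyc ?p, ?x} = b" and wyq: "w {?y, Cyc ?q} = b"
    using wc[of i] wc[of ?p] wc[of "Suc i mod g"] pq assms(3) by auto
  have deg: "degree ?E ?x = d" "degree ?E ?y = d" using assms(1,3) g3 by (auto simp: degree_sun_Cyc)
  have fC: "f (Cyc ?p) = 2 * b" "f ?x = b" "f ?y = 0" "f (Cyc ?q) = - b"
    and fL: "f (Leaf i j) = b + a" "f (Leaf (Suc i mod g) j) = - a" for j
    using dist by (simp_all add: f_def r h del: One_nat_def)
  have pred_y: "(Suc i mod g + g - 1) mod g = i" using assms(3) by (rule cyclic_succ_pred)
  note G = finite_connected_simple_graph_sun[OF g3, of d]
  have loop: "{u} \<notin> ?E" for u using sun_edges_simple(2)[OF g3, of "{u}" d] by auto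
  have nx: "nbrs ?E ?x = {?y, Cyc ?p} \<union> Leaf i ` {..<d - 2}"
    using nbrs_sun_Cyc[OF g3 assms(3)] .
  have ny: "nbrs ?E ?y = {Cyc ?q, ?x} \<union> Leaf (Suc i mod g) ` {..<d - 2}"
    using nbrs_sun_Cyc[OF g3 pq(1)] unfolding pred_y .
  have "has_LLY_curvature ?E w ?x ?y
    (1 - ((\<Sum>z\<in>nbrs ?E ?x. f z) / degree ?E ?x - (\<Sum>z\<in>nbrs ?E ?y. f z) / degree ?E ?y) / w {?x, ?y})"
  proof (rule has_LLY_curvature_potential[OF G pos xy])
    show "f u - f v \<le> w {u, v}" if "{u, v} \<in> ?E" for u v
      using that
    proof (cases rule: sun_edgesE)
      case (1 k)
      have "r k < g" using assms(3) by (simp add: r_def)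
      then have "\<bar>f (Cyc (Suc k mod g)) - f (Cyc k)\<bar> \<le> b"
        using h_lip[of "r k"] b by (simp add: f_def r_Suc abs_mult flip: right_diff_distrib)
      then show ?thesis using 1 wc[of k] by (auto simp: doubleton_eq_iff insert_commute)
    next
      case (2 k l)
      then show ?thesis using wl[of k l] a by (auto simp: doubleton_eq_iff f_def insert_commute)
    qed
    show "f ?x - f ?y = w {?x, ?y}" by (simp add: wxy fC)
  next
    fix \<alpha> :: real assume \<alpha>: "\<alpha> \<in> {1/2..1}"
    let ?N = "\<lambda>u. insert u (nbrs ?E u)"
    define \<psi> where "\<psi> v = (case v of Leaf k j \<Rightarrow> Leaf i j | Cyc k \<Rightarrow> if k = ?q then Cyc ?p else v)" for v
    have fin: "finite (nbrs ?E ?x)" "nbrs ?E ?x \<noteq> {}" "finite (nbrs ?E ?y)" "nbrs ?E ?y \<noteq> {}"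
      by (auto simp: nx ny)
    have \<psi>: "\<psi> ?y = ?y" "\<psi> ?x = ?x" "\<psi> (Cyc ?q) = Cyc ?p" "\<psi> (Leaf k j) = Leaf i j" for k j
      using dist by (auto simp: \<psi>_def)
    have bij: "bij_betw \<psi> (?N ?y) (?N ?x)"
      unfolding bij_betw_def
    proof
      show "inj_on \<psi> (?N ?y)" using dist by (auto simp: ny \<psi> inj_on_def)
      show "\<psi> ` ?N ?y = ?N ?x" by (auto simp: nx ny \<psi> image_iff)
    qed
    show "\<exists>\<pi>\<in>couplings (lazy_measure ?E \<alpha> ?x) (lazy_measure ?E \<alpha> ?y).
      \<forall>(u, v)\<in>set_pmf \<pi>. \<exists>p. is_path ?E u v p \<and> path_weight w p \<le> f u - f v"
    proof (rule lazy_measure_couplingI[OF \<alpha> fin(3,4) loop])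
      \<comment> \<open>Equal degrees give the same excess at both endpoints, and a bijection
        carries one uniform measure to the other.\<close>
      show "lazy_measure ?E \<alpha> ?x = bind_pmf (bernoulli_pmf (\<alpha> - (1 - \<alpha>) / degree ?E ?y))
          (\<lambda>b. if b then return_pmf ?x else map_pmf \<psi> (pmf_of_set (?N ?y)))"
        using lazy_measure_closed_nbrs(1)[OF \<alpha> fin(1,2) loop] map_pmf_of_set_bij_betw[OF bij] fin
        by (simp add: deg cong: if_cong)
      show "case (?x, ?y) of (u, v) \<Rightarrow> \<exists>p. is_path ?E u v p \<and> path_weight w p \<le> f u - f v"
        using xy wxy dist by (auto intro!: exI[of _ "[?x, ?y]"] simp: is_path_def fC)
      fix v assume "v \<in> ?N ?y"
      then consider "v = ?x \<or> v = ?y" | "v = Cyc ?q" | j where "j < d - 2" "v = Leaf (Suc i mod g) j"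
        by (auto simp: ny)
      then show "case (\<psi> v, v) of (u, v) \<Rightarrow> \<exists>p. is_path ?E u v p \<and> path_weight w p \<le> f u - f v"
      proof cases
        case 1
        then show ?thesis by (intro case_prodI exI[of _ "[v]"]) (auto simp: is_path_def \<psi>)
      next
        case 2
        then show ?thesis using xy py yq wxy wpx wyq dist
          by (intro case_prodI exI[of _ "[Cyc ?p, ?x, ?y, Cyc ?q]"])
            (auto simp: is_path_def \<psi> fC simp del: One_nat_def)
      next
        case (3 j)
        have "{Leaf i j, ?x} \<in> ?E" "{?y, v} \<in> ?E" "w {Leaf i j, ?x} = a" "w {?y, v} = a"
          using 3 sun_edgesI(2)[of _ g j d] wl[of _ j] pq assms(3) by (auto simp: insert_commute)
        then show ?thesis using 3(2) xy wxy dist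
          by (intro case_prodI exI[of _ "[Leaf i j, ?x, ?y, v]"]) (auto simp: is_path_def \<psi> fC fL)
      qed
    qed
  qed
  note curvature = this
  have sum_x: "(\<Sum>z\<in>nbrs ?E ?x. f z) = 2 * b + (real d - 2) * (b + a)"
    unfolding sum_nbrs_sun_Cyc[OF g3 assms(3)] fC fL using assms(1) by (simp add: of_nat_diff)
  have sum_y: "(\<Sum>z\<in>nbrs ?E ?y. f z) = - (real d - 2) * a"
    unfolding sum_nbrs_sun_Cyc[OF g3 pq(1)] pred_y fC fL
    using assms(1) by (simp add: of_nat_diff left_diff_distrib)
  have "1 - ((2 * b + (real d - 2) * (b + a)) / d - - (real d - 2) * a / d) / b =
      - 2 * (real d - 2) * (a / b) / d"
    using b assms(1) by (simp add: field_simps)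
  with curvature show ?thesis unfolding deg wxy sum_x sum_y by simp
qed

section \<open>Einstein metrics from positive eigenvectors\<close>

theorem theorem5p2:
  fixes g d :: nat
  assumes "d \<ge> 3" and "g \<ge> 6"
  shows "let E = sun_edges g d; R = ricci_matrix E; \<Lambda> = lambda_max E R in
    \<Lambda> = 2 * (sqrt (real d - 1) - 1) / real d \<and>
    (\<exists>w. eigenvector_on E R w \<Lambda> \<and> (\<forall>e\<in>E. 0 < w e)) \<and>
    (\<forall>w. eigenvector_on E R w \<Lambda> \<and> (\<forall>e\<in>E. 0 < w e) \<longrightarrow> discrete_Einstein_metric E w (- \<Lambda>)) \<and>
    - \<Lambda> < 0"
proof -
  let ?E = "sun_edges g d"
  define s where "s = sqrt (real d - 1)"
  define \<Lambda> where "\<Lambda> = 2 * (s - 1) / d"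
  have g3: "g \<ge> 3" using assms(2) by simp
  have s: "s\<^sup>2 = real d - 1" "s > 1" using assms(1) by (auto simp: s_def)
  define w\<^sub>0 where "w\<^sub>0 e = (if e \<subseteq> range Cyc then 1 + s else 1)" for e
  have w\<^sub>0: "eigenvector_on ?E (ricci_matrix ?E) w\<^sub>0 \<Lambda>"
    unfolding w\<^sub>0_def \<Lambda>_def s_def by (rule sun_eigenvector_exists[OF assms(1) g3])
  have w\<^sub>0_pos: "0 < w\<^sub>0 e" for e using s(2) by (simp add: w\<^sub>0_def)
  have max: "lambda_max ?E (ricci_matrix ?E) = \<Lambda>"
  proof (rule lambda_max_eq[OF sun_edges_simple(1)[OF g3] _ w\<^sub>0 w\<^sub>0_pos])
    show "0 \<le> ricci_matrix ?E e e'" if "e \<noteq> e'" for e e'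
      using that by (simp add: ricci_matrix_def sum_nonneg)
  qed
  have "discrete_Einstein_metric ?E w (- \<Lambda>)"
    if w: "eigenvector_on ?E (ricci_matrix ?E) w \<Lambda>" and pos: "\<forall>e\<in>?E. 0 < w e" for w
  proof -
    obtain a where wc: "\<And>i. i < g \<Longrightarrow> w {Cyc i, Cyc (Suc i mod g)} = (1 + s) * a"
      and wl: "\<And>i j. i < g \<Longrightarrow> j < d - 2 \<Longrightarrow> w {Cyc i, Leaf i j} = a"
      by (rule sun_eigenvector_unique[OF assms(1) g3, folded s_def, OF w[unfolded \<Lambda>_def]])
        (rule that; simp)
    have pos': "0 < w e" if "e \<in> ?E" for e using pos that by blast
    have "a > 0" using pos'[OF sun_edgesI(2)[of 0 g 0 d]] wl[of 0 0] assms by simp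
    \<comment> \<open>With t the ratio of cycle weight to leaf weight, the two curvatures agree iff
      t^2 - 2 t - (d - 2) = 0; its positive root is \<open>1 + s\<close>.\<close>
    have leaf: "(4 - 2 * ((1 + s) * a / a)) / d = - \<Lambda>"
    proof -
      have "4 - 2 * ((1 + s) * a / a) = - (2 * (s - 1))" using \<open>a > 0\<close> by simp
      then show ?thesis by (simp only: \<Lambda>_def minus_divide_left)
    qed
    have cycle: "- 2 * (real d - 2) * (a / ((1 + s) * a)) / d = - \<Lambda>"
    proof -
      have "real d - 2 = (s - 1) * (1 + s)" using s(1) by (simp add: power2_eq_square algebra_simps)
      then have "- 2 * (real d - 2) * (a / ((1 + s) * a)) = - (2 * (s - 1))"
        using \<open>a > 0\<close> s(2) by simp
      then show ?thesis by (simp only: \<Lambda>_def minus_divide_left)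
    qed
    \<comment> \<open>The pair may match the edge in either order, so symmetry of the curvature is
      applied.\<close>
    have "has_LLY_curvature ?E w x y (- \<Lambda>)" if "{x, y} \<in> ?E" for x y
      using that
    proof (cases rule: sun_edgesE)
      case (1 i)
      have "has_LLY_curvature ?E w (Cyc i) (Cyc (Suc i mod g)) (- \<Lambda>)"
        using sun_cycle_curvature[OF assms 1(1) pos' wc wl] unfolding cycle .
      then show ?thesis using 1(2) has_LLY_curvature_commute[of ?E w x y]
        by (auto simp only: doubleton_eq_iff)
    next
      case (2 i j)
      have "has_LLY_curvature ?E w (Leaf i j) (Cyc i) (- \<Lambda>)"
        using sun_leaf_curvature[OF assms(1) g3 2(1,2) pos' wc wl] unfolding leaf .
      then show ?thesis using 2(3) has_LLY_curvature_commute[of ?E w x y]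
        by (auto simp only: doubleton_eq_iff)
    qed
    then show ?thesis using pos by (simp add: discrete_Einstein_metric_def)
  qed
  moreover have "- \<Lambda> < 0" using s(2) assms(1) by (simp add: \<Lambda>_def)
  ultimately show ?thesis
    unfolding Let_def max using w\<^sub>0 w\<^sub>0_pos
    by (intro conjI) (simp only: \<Lambda>_def s_def, blast+)
qed

end
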